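(* Let $R$ be a zero dimensional commutative ring. Then the primitive idempotents of $R$ are in bijection with the isolated points of $\operatorname{Spec}(R)$.
   Context: All rings are commutative with $1$. A ring is zero dimensional if its Krull dimension is $0$ (every prime ideal is maximal). A nonzero idempotent $e\in R$ is primitive if whenever $e'=ee'$ for some nonzero idempotent $e'\in R$, then $e'=e$. A point $x$ of a topological space is isolated if $\{x\}$ is open; $\operatorname{Spec}(R)$ carries the Zariski topology. *)

theory Defs
  imports
    "HOL-Algebra.Ideal"
    "HOL-Library.Extended_Nat"
    "HOL-Analysis.Abstract_Topology"
begin

section \<open>Prime spectrum with the Zariski topology\<close>

definition Spec :: "('a, 'b) ring_scheme \<Rightarrow> 'a set set" where
  "Spec R = {P. primeideal P R}"

definition zariski_closed :: "('a, 'b) ring_scheme \<Rightarrow> 'a set \<Rightarrow> 'a set set" where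
  "zariski_closed R S = {P \<in> Spec R. S \<subseteq> P}"

definition zariski :: "('a, 'b) ring_scheme \<Rightarrow> 'a set topology" where
  "zariski R = topology (\<lambda>U. \<exists>S \<subseteq> carrier R. U = Spec R - zariski_closed R S)"

definition isolated_points :: "'x topology \<Rightarrow> 'x set" where
  "isolated_points X = {x \<in> topspace X. openin X {x}}"

text \<open>
  The function given to \<^const>\<open>topology\<close> satisfies \<^const>\<open>istopology\<close>, for every ring,
  so \<^const>\<open>zariski\<close> has the intended open sets.
\<close>

lemma istopology_zariski:
  fixes R (structure)
  assumes "ring R"
  shows "istopology (\<lambda>U. \<exists>S \<subseteq> carrier R. U = Spec R - zariski_closed R S)"
  unfolding istopology_def
proof (intro conjI allI impI)
  interpret ring R by fact
  fix U V
  assume "\<exists>S \<subseteq> carrier R. U = Spec R - zariski_closed R S"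
    and "\<exists>S \<subseteq> carrier R. V = Spec R - zariski_closed R S"
  then obtain S T where S: "S \<subseteq> carrier R" "U = Spec R - zariski_closed R S"
    and T: "T \<subseteq> carrier R" "V = Spec R - zariski_closed R T"
    by auto
  define W where "W = {s \<otimes> t | s t. s \<in> S \<and> t \<in> T}"
  have "W \<subseteq> P \<longleftrightarrow> S \<subseteq> P \<or> T \<subseteq> P" if "primeideal P R" for P
  proof -
    interpret primeideal P R by fact
    show ?thesis
    proof
      assume *: "W \<subseteq> P"
      show "S \<subseteq> P \<or> T \<subseteq> P"
      proof (rule ccontr)
        assume "\<not> (S \<subseteq> P \<or> T \<subseteq> P)"
        then obtain s t where st: "s \<in> S" "s \<notin> P" "t \<in> T" "t \<notin> P" by auto
        then have "s \<otimes> t \<in> P" using * by (auto simp: W_def)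
        then show False using I_prime[of s t] st S(1) T(1) by auto
      qed
    next
      assume "S \<subseteq> P \<or> T \<subseteq> P"
      then show "W \<subseteq> P"
        using S(1) T(1) I_l_closed I_r_closed by (auto simp: W_def subset_iff)
    qed
  qed
  then have "U \<inter> V = Spec R - zariski_closed R W"
    using S T by (auto simp: zariski_closed_def Spec_def)
  moreover have "W \<subseteq> carrier R"
    using S T by (auto simp: W_def)
  ultimately show "\<exists>S \<subseteq> carrier R. U \<inter> V = Spec R - zariski_closed R S"
    by blast
next
  fix K :: "'a set set set"
  assume "\<forall>U\<in>K. \<exists>S \<subseteq> carrier R. U = Spec R - zariski_closed R S"
  then obtain f where f: "\<And>U. U \<in> K \<Longrightarrow> f U \<subseteq> carrier R \<and> U = Spec R - zariski_closed R (f U)"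
    by metis
  have "\<Union>K = (\<Union>U\<in>K. Spec R - zariski_closed R (f U))"
    using f by blast
  also have "\<dots> = Spec R - zariski_closed R (\<Union>U\<in>K. f U)"
    by (auto simp: zariski_closed_def)
  finally show "\<exists>S \<subseteq> carrier R. \<Union>K = Spec R - zariski_closed R S"
    using f by (intro exI[of _ "\<Union>U\<in>K. f U"]) blast
qed

lemma openin_zariski:
  assumes "ring R"
  shows "openin (zariski R) U \<longleftrightarrow> (\<exists>S \<subseteq> carrier R. U = Spec R - zariski_closed R S)"
  unfolding zariski_def topology_inverse'[OF istopology_zariski[OF assms]] ..

lemma topspace_zariski:
  assumes "ring R"
  shows "topspace (zariski R) = Spec R"
proof -
  have "zariski_closed R (carrier R) = {}"
  proof -
    have False if "primeideal P R" "carrier R \<subseteq> P" for P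
    proof -
      interpret primeideal P R by fact
      show False using that(2) a_subset I_notcarr by blast
    qed
    then show ?thesis by (auto simp: zariski_closed_def Spec_def)
  qed
  then have "openin (zariski R) (Spec R)"
    unfolding openin_zariski[OF assms] by (intro exI[of _ "carrier R"]) simp
  moreover have "U \<subseteq> Spec R" if "openin (zariski R) U" for U
    using that unfolding openin_zariski[OF assms] by blast
  ultimately show ?thesis
    by (meson openin_subset openin_topspace subset_antisym)
qed

section \<open>Krull dimension\<close>

text \<open>
  The supremum of the lengths \<open>n\<close> of strict chains \<open>P 0 \<subset> \<dots> \<subset> P n\<close> of prime ideals, in
  \<^typ>\<open>enat\<close>. As \<open>Sup {} = 0\<close> there, the zero ring has dimension 0, which agrees with reading
  \<open>zero dimensional\<close> as: every prime ideal is maximal. See \<open>zero_dimensional_iff\<close> below.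
\<close>

definition krull_dim :: "('a, 'b) ring_scheme \<Rightarrow> enat" where
  "krull_dim R = Sup {enat n | n. \<exists>P :: nat \<Rightarrow> 'a set.
     (\<forall>i\<le>n. primeideal (P i) R) \<and> (\<forall>i<n. P i \<subset> P (Suc i))}"

definition zero_dimensional :: "('a, 'b) ring_scheme \<Rightarrow> bool" where
  "zero_dimensional R \<longleftrightarrow> krull_dim R = 0"

lemma (in cring) ex_maximalideal:
  assumes J: "ideal J R" "J \<noteq> carrier R"
  obtains M where "maximalideal M R" "J \<subseteq> M"
proof -
  define A where "A = {I. ideal I R \<and> J \<subseteq> I \<and> \<one> \<notin> I}"
  have "\<exists>M\<in>A. \<forall>X\<in>A. M \<subseteq> X \<longrightarrow> X = M"
  proof (rule subset_Zorn_nonempty)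
    show "A \<noteq> {}"
      using J ideal.one_imp_carrier by (auto simp: A_def)
    fix C assume "C \<noteq> {}" and C: "subset.chain A C"
    then obtain I0 where I0: "I0 \<in> C" by blast
    have CA: "C \<subseteq> A" using C by (auto simp: subset_chain_def)
    have tot: "X \<subseteq> Y \<or> Y \<subseteq> X" if "X \<in> C" "Y \<in> C" for X Y
      using C that by (auto simp: subset_chain_def)
    have id: "ideal I R" if "I \<in> C" for I using that CA by (auto simp: A_def)
    have sg: "additive_subgroup I R" if "I \<in> C" for I
      using id[OF that] by (rule ideal.axioms(1))
    have "ideal (\<Union>C) R"
    proof (rule idealI)
      show "ring R" by (rule ring_axioms)
      show "subgroup (\<Union>C) (add_monoid R)"
      proof (rule add.subgroupI)
        show "\<Union>C \<subseteq> carrier R" using additive_subgroup.a_subset[OF sg] by blast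
        show "\<Union>C \<noteq> {}" using additive_subgroup.zero_closed[OF sg[OF I0]] I0 by blast
        show "\<ominus> a \<in> \<Union>C" if "a \<in> \<Union>C" for a
          using that additive_subgroup.a_inv_closed[OF sg] by blast
        show "a \<oplus> b \<in> \<Union>C" if ab: "a \<in> \<Union>C" "b \<in> \<Union>C" for a b
        proof -
          obtain X Y where XY: "X \<in> C" "a \<in> X" "Y \<in> C" "b \<in> Y" using ab by blast
          then obtain Z where "Z \<in> C" "a \<in> Z" "b \<in> Z" using tot by blast
          then show ?thesis using additive_subgroup.a_closed[OF sg] by blast
        qed
      qed
      show "x \<otimes> a \<in> \<Union>C" if "a \<in> \<Union>C" "x \<in> carrier R" for a x
        using that ideal.I_l_closed[OF id] by blast
      show "a \<otimes> x \<in> \<Union>C" if "a \<in> \<Union>C" "x \<in> carrier R" for a x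
        using that ideal.I_r_closed[OF id] by blast
    qed
    then show "\<Union>C \<in> A" using CA I0 by (auto simp: A_def)
  qed
  then obtain M where M: "M \<in> A" and max: "\<And>X. X \<in> A \<Longrightarrow> M \<subseteq> X \<Longrightarrow> X = M" by blast
  have "maximalideal M R"
  proof (rule maximalidealI)
    show "ideal M R" using M by (simp add: A_def)
    show "carrier R \<noteq> M" using M by (auto simp: A_def)
    fix I assume I: "ideal I R" "M \<subseteq> I" "I \<subseteq> carrier R"
    show "I = M \<or> I = carrier R"
    proof (cases "\<one> \<in> I")
      case True
      then show ?thesis using ideal.one_imp_carrier[OF I(1)] by simp
    next
      case False
      then show ?thesis using max[of I] I M by (auto simp: A_def)
    qed
  qed
  then show thesis using that M by (auto simp: A_def)
qed

lemma zero_dimensional_chain_iff: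
  "zero_dimensional R \<longleftrightarrow>
    (\<forall>n (P :: nat \<Rightarrow> 'a set). (\<forall>i\<le>n. primeideal (P i) R) \<and> (\<forall>i<n. P i \<subset> P (Suc i)) \<longrightarrow> n = 0)"
  for R :: "('a, 'b) ring_scheme"
proof -
  have "zero_dimensional R \<longleftrightarrow> krull_dim R \<le> 0"
    by (simp add: zero_dimensional_def)
  also have "\<dots> \<longleftrightarrow>
      (\<forall>n (P :: nat \<Rightarrow> 'a set). (\<forall>i\<le>n. primeideal (P i) R) \<and> (\<forall>i<n. P i \<subset> P (Suc i)) \<longrightarrow> enat n \<le> 0)"
    unfolding krull_dim_def Sup_le_iff by blast
  finally show ?thesis
    by (simp add: zero_enat_def)
qed

lemma zero_dimensional_iff:
  fixes R (structure)
  assumes "cring R"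
  shows "zero_dimensional R \<longleftrightarrow> (\<forall>P. primeideal P R \<longrightarrow> maximalideal P R)"
proof
  interpret cring R by fact
  assume "zero_dimensional R"
  then have no_chain: "n = 0"
    if "\<forall>i\<le>n. primeideal (P i) R" "\<forall>i<n. P i \<subset> P (Suc i)" for n and P :: "nat \<Rightarrow> 'a set"
    using that unfolding zero_dimensional_chain_iff by blast
  show "\<forall>P. primeideal P R \<longrightarrow> maximalideal P R"
  proof (intro allI impI)
    fix P assume P: "primeideal P R"
    interpret primeideal P R by fact
    obtain M where M: "maximalideal M R" "P \<subseteq> M"
      using ex_maximalideal[OF is_ideal] I_notcarr by metis
    have "P = M"
    proof (rule ccontr)
      assume "P \<noteq> M"
      then have "P \<subset> M" using M(2) by blast
      moreover have "primeideal (if i = 0 then P else M) R" for i :: nat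
        using P maximalideal_prime[OF M(1)] by simp
      ultimately have "(1::nat) = 0"
        using no_chain[of 1 "\<lambda>i. if i = 0 then P else M"] by simp
      then show False by simp
    qed
    then show "maximalideal P R" using M by simp
  qed
next
  assume max: "\<forall>P. primeideal P R \<longrightarrow> maximalideal P R"
  have "n = 0"
    if P: "\<forall>i\<le>n. primeideal (P i) R" "\<forall>i<n. P i \<subset> P (Suc i)" for n and P :: "nat \<Rightarrow> 'a set"
  proof (rule ccontr)
    assume "n \<noteq> 0"
    then have p: "primeideal (P 0) R" "primeideal (P (Suc 0)) R" "P 0 \<subset> P (Suc 0)"
      using P by auto
    interpret m: maximalideal "P 0" R using max p by blast
    interpret q: primeideal "P (Suc 0)" R using p by blast
    show False
      using m.I_maximal[OF q.is_ideal _ q.a_subset] p q.I_notcarr by blast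
  qed
  then show "zero_dimensional R"
    unfolding zero_dimensional_chain_iff by blast
qed

section \<open>Primitive idempotents\<close>

definition primitive_idempotents :: "('a, 'b) ring_scheme \<Rightarrow> 'a set" where
  "primitive_idempotents R =
    {e \<in> carrier R. e \<noteq> \<zero>\<^bsub>R\<^esub> \<and> e \<otimes>\<^bsub>R\<^esub> e = e \<and>
      (\<forall>e' \<in> carrier R. e' \<noteq> \<zero>\<^bsub>R\<^esub> \<and> e' \<otimes>\<^bsub>R\<^esub> e' = e' \<and> e' = e \<otimes>\<^bsub>R\<^esub> e' \<longrightarrow> e' = e)}"

end

(* Write D(a) for the set of primes not containing a. In a zero dimensional ring every a satisfies
   a^n = a^(n+1) x for some n and x, since otherwise some prime would avoid all a^n (1 - a x),
   whereas modulo a prime not containing a the element a is invertible. Then (a x)^(n+1) is an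
   idempotent g with D(g) = D(a). As an idempotent e is determined by D(e), the primitive
   idempotents correspond to the minimal nonempty D(e); these are singletons because any two
   primes are separated by some D(g), and every open singleton has the form D(a). *)
theory Submission
  imports Defs "HOL-Algebra.Ring_Divisibility"
begin

section \<open>Primes avoiding a multiplicative set\<close>

lemma (in cring) ex_primeideal_disjoint:
  assumes S: "S \<subseteq> carrier R" "\<one> \<in> S" "\<zero> \<notin> S"
    and mult: "\<And>s t. s \<in> S \<Longrightarrow> t \<in> S \<Longrightarrow> s \<otimes> t \<in> S"
  obtains P where "primeideal P R" "P \<inter> S = {}"
proof -
  define A where "A = {I. ideal I R \<and> I \<inter> S = {}}"
  have "\<exists>M\<in>A. \<forall>X\<in>A. M \<subseteq> X \<longrightarrow> X = M"
  proof (rule subset_Zorn_nonempty)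
    show "A \<noteq> {}"
      using zeroideal S by (auto simp: A_def)
    fix C assume "C \<noteq> {}" and C: "subset.chain A C"
    then have "subset.chain {I. ideal I R} C"
      by (auto simp: subset_chain_def A_def)
    from chain_Union_is_ideal[OF this] show "\<Union>C \<in> A"
      using \<open>C \<noteq> {}\<close> C by (auto simp: subset_chain_def A_def)
  qed
  then obtain M where M: "ideal M R" "M \<inter> S = {}"
    and max: "\<And>X. ideal X R \<Longrightarrow> X \<inter> S = {} \<Longrightarrow> M \<subseteq> X \<Longrightarrow> X = M"
    by (auto simp: A_def)
  interpret M: ideal M R by fact
  \<comment> \<open>The ideal M, maximal by Zorn among the ideals disjoint from S, is the desired
    prime. Its maximality is used in this form: M + (a) properly contains M, so it cannot be
    disjoint from S.\<close>
  have meets: "\<exists>m\<in>M. \<exists>r\<in>carrier R. m \<oplus> r \<otimes> a \<in> S" if a: "a \<in> carrier R" "a \<notin> M" for a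
  proof -
    have I: "ideal (M <+> PIdl a) R"
      by (rule add_ideals[OF M(1) cgenideal_ideal[OF a(1)]])
    have mem: "m \<oplus> r \<otimes> a \<in> M <+> PIdl a" if "m \<in> M" "r \<in> carrier R" for m r
      using that unfolding set_add_def' cgenideal_def by blast
    have "M \<subseteq> M <+> PIdl a"
      using mem[of _ \<zero>] a by force
    moreover have "a \<in> M <+> PIdl a"
      using mem[of \<zero> \<one>] a by simp
    ultimately have "(M <+> PIdl a) \<inter> S \<noteq> {}"
      using max[OF I] a by blast
    then show ?thesis
      unfolding set_add_def' cgenideal_def by blast
  qed
  have "primeideal M R"
  proof (rule primeidealI)
    show "ideal M R" "cring R" by unfold_locales
    show "carrier R \<noteq> M" using M(2) S by blast
    fix a b assume ab: "a \<in> carrier R" "b \<in> carrier R" "a \<otimes> b \<in> M"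
    show "a \<in> M \<or> b \<in> M"
    proof (rule ccontr)
      assume "\<not> (a \<in> M \<or> b \<in> M)"
      then obtain m r m' r' where mr: "m \<in> M" "r \<in> carrier R" "m \<oplus> r \<otimes> a \<in> S"
        "m' \<in> M" "r' \<in> carrier R" "m' \<oplus> r' \<otimes> b \<in> S"
        using meets ab by meson
      have c: "m \<in> carrier R" "m' \<in> carrier R"
        using mr M.Icarr by auto
      \<comment> \<open>Arranged so that each summand has a factor m, m' or
        \<open>a \<otimes> b\<close> from M. The product lies in S by multiplicativity and in M by
        this expansion, which contradicts disjointness.\<close>
      have "(m \<oplus> r \<otimes> a) \<otimes> (m' \<oplus> r' \<otimes> b)
          = (m' \<oplus> r' \<otimes> b) \<otimes> m \<oplus> ((r \<otimes> a) \<otimes> m' \<oplus> (r \<otimes> r') \<otimes> (a \<otimes> b))"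
        using mr c ab by algebra
      also have "\<dots> \<in> M"
        using mr c ab by (simp add: M.a_closed M.I_l_closed)
      finally show False
        using mult mr M(2) by blast
    qed
  qed
  then show thesis using M(2) that by blast
qed

section \<open>Basic open sets D(a) and idempotents\<close>

definition basic_open :: "('a, 'b) ring_scheme \<Rightarrow> 'a \<Rightarrow> 'a set set" where
  "basic_open R a = {P \<in> Spec R. a \<notin> P}"

lemma openin_basic_open:
  assumes "ring R" "a \<in> carrier R"
  shows "openin (zariski R) (basic_open R a)"
  unfolding openin_zariski[OF assms(1)] using assms(2)
  by (intro exI[of _ "{a}"]) (auto simp: basic_open_def zariski_closed_def)

context cring
begin

lemma basic_open_mult:
  assumes "a \<in> carrier R" "b \<in> carrier R"
  shows "basic_open R (a \<otimes> b) = basic_open R a \<inter> basic_open R b"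
proof -
  have "a \<otimes> b \<in> P \<longleftrightarrow> a \<in> P \<or> b \<in> P" if "primeideal P R" for P
  proof -
    interpret P: primeideal P R by fact
    show ?thesis using assms P.I_prime P.I_l_closed P.I_r_closed by blast
  qed
  then show ?thesis by (auto simp: basic_open_def Spec_def)
qed

lemma basic_open_zero: "basic_open R \<zero> = {}"
  by (auto simp: basic_open_def Spec_def primeideal_def ideal_def
      intro: additive_subgroup.zero_closed)

lemma basic_open_pow:
  assumes "a \<in> carrier R"
  shows "basic_open R (a [^] Suc n) = basic_open R a"
  using assms by (induction n) (auto simp: basic_open_mult)

text \<open>For idempotent e the set {1, e} is multiplicative, so if e is nonzero then some prime
  avoids e. For a general element, an empty D(a) gives only nilpotency.\<close>

lemma idempotent_eq_zero:
  assumes e: "e \<in> carrier R" "e \<otimes> e = e" and empty: "basic_open R e = {}"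
  shows "e = \<zero>"
proof (rule ccontr)
  assume "e \<noteq> \<zero>"
  then have "\<one> \<noteq> \<zero>"
    using e by (metis l_one l_null)
  then obtain P where "primeideal P R" "P \<inter> {\<one>, e} = {}"
    using ex_primeideal_disjoint[of "{\<one>, e}"] e \<open>e \<noteq> \<zero>\<close>
    by (metis empty_iff empty_subsetI insert_iff insert_subset l_one one_closed r_one)
  then show False
    using empty by (auto simp: basic_open_def Spec_def)
qed

lemma idempotent_mult:
  assumes "e \<in> carrier R" "e \<otimes> e = e" "f \<in> carrier R" "f \<otimes> f = f"
  shows "(e \<otimes> f) \<otimes> (e \<otimes> f) = e \<otimes> f"
  using assms by (metis m_assoc m_closed m_comm)

text \<open>The complement 1 - f is an idempotent with D(1 - f) disjoint from D(f). Hence e(1 - f)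
  is an idempotent with empty basic open set, so it vanishes, and e = ef + e(1 - f) gives the
  claim.\<close>

lemma idempotent_mult_eq:
  assumes e: "e \<in> carrier R" "e \<otimes> e = e" and f: "f \<in> carrier R" "f \<otimes> f = f"
    and sub: "basic_open R e \<subseteq> basic_open R f"
  shows "e \<otimes> f = e"
proof -
  have c: "\<one> \<ominus> f \<in> carrier R" using f by simp
  have "(\<one> \<ominus> f) \<otimes> (\<one> \<ominus> f) = \<one> \<ominus> f \<ominus> f \<oplus> f \<otimes> f"
    using f(1) by algebra
  also have "\<dots> = \<one> \<ominus> f"
    unfolding f(2) using f(1) by algebra
  finally have idem: "(\<one> \<ominus> f) \<otimes> (\<one> \<ominus> f) = \<one> \<ominus> f" .
  have "f \<otimes> (\<one> \<ominus> f) = f \<ominus> f \<otimes> f"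
    using f(1) by algebra
  then have "f \<otimes> (\<one> \<ominus> f) = \<zero>"
    using f by (simp add: r_neg minus_eq)
  then have "basic_open R f \<inter> basic_open R (\<one> \<ominus> f) = {}"
    using basic_open_mult[OF f(1) c] basic_open_zero by simp
  then have "basic_open R (e \<otimes> (\<one> \<ominus> f)) = {}"
    using basic_open_mult[OF e(1) c] sub by blast
  then have "e \<otimes> (\<one> \<ominus> f) = \<zero>"
    using idempotent_mult[OF e c idem] e c by (intro idempotent_eq_zero) auto
  moreover have "e = e \<otimes> f \<oplus> e \<otimes> (\<one> \<ominus> f)"
    using e(1) f(1) by algebra
  ultimately show ?thesis
    using e f by (metis m_closed r_zero)
qed

lemma idempotent_eq:
  assumes "e \<in> carrier R" "e \<otimes> e = e" "f \<in> carrier R" "f \<otimes> f = f"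
    and "basic_open R e = basic_open R f"
  shows "e = f"
  using idempotent_mult_eq[of e f] idempotent_mult_eq[of f e] assms m_comm by simp

section \<open>Idempotents from dimension zero\<close>

lemma zero_dimensional_pi_regular:
  assumes zd: "zero_dimensional R" and a: "a \<in> carrier R"
  obtains n :: nat and x where "x \<in> carrier R" "a [^] n \<otimes> (a \<otimes> x) = a [^] n"
proof -
  \<comment> \<open>Membership of \<open>\<zero>\<close> in this set is the claimed equation in
    another form.\<close>
  define S where "S = {a [^] n \<otimes> (\<one> \<ominus> a \<otimes> x) | (n::nat) x. x \<in> carrier R}"
  have memS: "a [^] n \<otimes> (\<one> \<ominus> a \<otimes> x) \<in> S" if "x \<in> carrier R" for n :: nat and x
    using that by (auto simp: S_def)
  have "\<zero> \<in> S"
  proof (rule ccontr)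
    assume "\<zero> \<notin> S"
    have S1: "\<one> \<in> S" and Sa: "a \<in> S"
      using memS[of \<zero> 0] memS[of \<zero> 1] a by (simp_all add: minus_eq)
    have "s \<otimes> t \<in> S" if st: "s \<in> S" "t \<in> S" for s t
    proof -
      obtain n m :: nat and x y where
        s: "x \<in> carrier R" "s = a [^] n \<otimes> (\<one> \<ominus> a \<otimes> x)" and
        t: "y \<in> carrier R" "t = a [^] m \<otimes> (\<one> \<ominus> a \<otimes> y)"
        using st unfolding S_def by blast
      have p: "a [^] n \<in> carrier R" "a [^] m \<in> carrier R" using a by auto
      \<comment> \<open>Closure rests on (1 - ax)(1 - ay) = 1 - a(x + y - axy).\<close>
      have "s \<otimes> t = (a [^] n \<otimes> a [^] m) \<otimes> (\<one> \<ominus> a \<otimes> (x \<oplus> y \<ominus> a \<otimes> x \<otimes> y))"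
        unfolding s(2) t(2) using s(1) t(1) a p by algebra
      also have "\<dots> = a [^] (n + m) \<otimes> (\<one> \<ominus> a \<otimes> (x \<oplus> y \<ominus> a \<otimes> x \<otimes> y))"
        using a by (simp add: nat_pow_mult)
      finally show ?thesis
        using memS s(1) t(1) a by simp
    qed
    moreover have "S \<subseteq> carrier R"
      using a by (auto simp: S_def)
    ultimately obtain P where P: "primeideal P R" "P \<inter> S = {}"
      using ex_primeideal_disjoint[of S] S1 \<open>\<zero> \<notin> S\<close> by blast
    interpret P: maximalideal P R
      using zd P(1) zero_dimensional_iff[OF is_cring] by blast
    have I: "ideal (P <+> PIdl a) R"
      by (rule add_ideals[OF P.is_ideal cgenideal_ideal[OF a]])
    have mem: "m \<oplus> r \<otimes> a \<in> P <+> PIdl a" if "m \<in> P" "r \<in> carrier R" for m r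
      using that unfolding set_add_def' cgenideal_def by blast
    have "P \<subseteq> P <+> PIdl a"
      using mem[of _ \<zero>] a by force
    moreover have "a \<in> P <+> PIdl a"
      using mem[of \<zero> \<one>] a by simp
    \<comment> \<open>Since a itself lies in S (take n = 1, x = 0), the prime P does not contain a;
      being maximal, it generates the whole ring together with a.\<close>
    ultimately have "P <+> PIdl a = carrier R"
      using P.I_maximal[OF I] P(2) Sa ideal.Icarr[OF I] by blast
    then obtain m r where mr: "m \<in> P" "r \<in> carrier R" "\<one> = m \<oplus> r \<otimes> a"
      using one_closed unfolding set_add_def' cgenideal_def by blast
    have "m \<in> carrier R" using mr P.Icarr by blast
    have "m = (m \<oplus> r \<otimes> a) \<ominus> a \<otimes> r"
      using \<open>m \<in> carrier R\<close> mr(2) a by algebra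
    then have "\<one> \<ominus> a \<otimes> r \<in> P"
      using mr by simp
    \<comment> \<open>This is the case n = 0 of the definition of S, so an inverse r of a modulo P
      produces an element of both P and S.\<close>
    moreover have "\<one> \<ominus> a \<otimes> r \<in> S"
      using memS[of r 0] mr(2) a by simp
    ultimately show False using P(2) by blast
  qed
  then obtain n :: nat and x where x: "x \<in> carrier R" "\<zero> = a [^] n \<otimes> (\<one> \<ominus> a \<otimes> x)"
    by (auto simp: S_def)
  have p: "a [^] n \<in> carrier R" using a by simp
  have "a [^] n = a [^] n \<otimes> (\<one> \<ominus> a \<otimes> x) \<oplus> a [^] n \<otimes> (a \<otimes> x)"
    using p a x(1) by algebra
  then have "a [^] n \<otimes> (a \<otimes> x) = a [^] n"
    using x p a by (metis l_zero m_closed)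
  with x(1) show thesis by (rule that)
qed

lemma zero_dimensional_ex_idempotent:
  assumes zd: "zero_dimensional R" and a: "a \<in> carrier R"
  obtains g where "g \<in> carrier R" "g \<otimes> g = g" "basic_open R g = basic_open R a"
proof -
  obtain n :: nat and x where x: "x \<in> carrier R" and eq: "a [^] n \<otimes> (a \<otimes> x) = a [^] n"
    using zero_dimensional_pi_regular[OF zd a] .
  define y where "y = a \<otimes> x"
  have y: "y \<in> carrier R" and ay: "a [^] n \<otimes> y = a [^] n"
    using a x eq by (auto simp: y_def)
  have any: "a [^] n \<otimes> y [^] k = a [^] n" for k :: nat
    using a y ay by (induction k) (simp_all flip: m_assoc)
  \<comment> \<open>As y^n is a multiple of a^n, on which y acts as the identity, y also fixes
    y^n.\<close>
  have yn: "y [^] n = x [^] n \<otimes> a [^] n"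
    using a x by (simp add: y_def nat_pow_distrib m_comm)
  have yny: "y [^] n \<otimes> y [^] k = y [^] n" for k :: nat
    unfolding yn using any[of k] a x y by (simp add: m_assoc)
  \<comment> \<open>The exponent is \<open>Suc n\<close> because \<open>basic_open_pow\<close>
    requires a positive one, and n may be 0.\<close>
  have "y [^] Suc n \<otimes> y [^] Suc n = y [^] n \<otimes> y [^] (1 + Suc n)"
    using y by (simp add: m_ac)
  also have "\<dots> = y [^] n \<otimes> y [^] (1::nat)"
    unfolding yny ..
  finally have "y [^] Suc n \<otimes> y [^] Suc n = y [^] Suc n"
    using y by simp
  moreover have "basic_open R (y [^] Suc n) = basic_open R a"
  proof
    show "basic_open R (y [^] Suc n) \<subseteq> basic_open R a"
      unfolding basic_open_pow[OF y] using basic_open_mult[OF a x] by (simp add: y_def)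
    have "basic_open R a = basic_open R (a [^] n \<otimes> a)"
      using basic_open_pow[OF a, of n] by simp
    \<comment> \<open>Inserting the factor y exhibits a power of a as a multiple of y, whence D(a)
      is contained in D(y).\<close>
    also have "a [^] n \<otimes> a = (a [^] n \<otimes> a) \<otimes> y"
      using a y ay by (metis m_assoc m_comm nat_pow_closed)
    also have "basic_open R \<dots> \<subseteq> basic_open R y"
      using basic_open_mult[of "a [^] n \<otimes> a" y] a y by simp
    finally show "basic_open R a \<subseteq> basic_open R (y [^] Suc n)"
      unfolding basic_open_pow[OF y] .
  qed
  ultimately show thesis
    using that[of "y [^] Suc n"] y by blast
qed

section \<open>Primitive idempotents and isolated points\<close>

lemma zero_dimensional_Spec_antichain:
  assumes "zero_dimensional R" "P \<in> Spec R" "Q \<in> Spec R" "P \<subseteq> Q"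
  shows "P = Q"
proof -
  interpret P: maximalideal P R
    using assms zero_dimensional_iff[OF is_cring] by (auto simp: Spec_def)
  interpret Q: primeideal Q R
    using assms by (simp add: Spec_def)
  show ?thesis
    using P.I_maximal[OF Q.is_ideal assms(4) Q.a_subset] Q.I_notcarr by blast
qed

text \<open>If D(e) held distinct primes P and Q, some a would lie in P but not in Q. With g an
  idempotent such that D(g) = D(a), the idempotent eg lies below e, is nonzero because of Q, and
  differs from e because of P, against primitivity.\<close>

lemma primitive_idempotent_basic_open:
  assumes zd: "zero_dimensional R" and e: "e \<in> primitive_idempotents R"
  obtains P where "P \<in> Spec R" "basic_open R e = {P}"
proof -
  have ec: "e \<in> carrier R" "e \<otimes> e = e" "e \<noteq> \<zero>"
    and prim: "\<And>f. f \<in> carrier R \<Longrightarrow> f \<noteq> \<zero> \<Longrightarrow> f \<otimes> f = f \<Longrightarrow> f = e \<otimes> f \<Longrightarrow> f = e"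
    using e by (auto simp: primitive_idempotents_def)
  have "Q = P" if PQ: "P \<in> basic_open R e" "Q \<in> basic_open R e" for P Q
  proof (rule ccontr)
    assume "Q \<noteq> P"
    have S: "P \<in> Spec R" "Q \<in> Spec R" using PQ by (auto simp: basic_open_def)
    then obtain a where a: "a \<in> P" "a \<notin> Q"
      using zero_dimensional_Spec_antichain[OF zd] \<open>Q \<noteq> P\<close> by blast
    have "P \<subseteq> carrier R"
      using S primeideal.axioms(1) ideal.Icarr by (fastforce simp: Spec_def)
    then obtain g where g: "g \<in> carrier R" "g \<otimes> g = g" "basic_open R g = basic_open R a"
      using zero_dimensional_ex_idempotent[OF zd] a by blast
    have D: "basic_open R (e \<otimes> g) = basic_open R e \<inter> basic_open R a"
      using basic_open_mult ec g by simp
    then have "Q \<in> basic_open R (e \<otimes> g)" "P \<notin> basic_open R (e \<otimes> g)"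
      using PQ S a by (auto simp: basic_open_def)
    moreover from this have "e \<otimes> g \<noteq> \<zero>"
      using basic_open_zero by auto
    moreover have "e \<otimes> g = e \<otimes> (e \<otimes> g)"
      using ec g by (simp flip: m_assoc)
    ultimately have "e \<otimes> g = e"
      using prim[of "e \<otimes> g"] idempotent_mult[of e g] ec g by simp
    then show False
      using PQ \<open>P \<notin> basic_open R (e \<otimes> g)\<close> by simp
  qed
  moreover have "basic_open R e \<noteq> {}"
    using idempotent_eq_zero ec by blast
  ultimately obtain P where "basic_open R e = {P}"
    by blast
  moreover from this have "P \<in> Spec R"
    by (auto simp: basic_open_def)
  ultimately show thesis
    using that by blast
qed

lemma isolated_point_primitive_idempotent:
  assumes zd: "zero_dimensional R" and P: "P \<in> isolated_points (zariski R)"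
  obtains e where "e \<in> primitive_idempotents R" "basic_open R e = {P}"
proof -
  obtain S where S: "S \<subseteq> carrier R" "{P} = Spec R - zariski_closed R S"
    using P openin_zariski[OF ring_axioms] by (auto simp: isolated_points_def)
  then have "P \<in> Spec R - zariski_closed R S" by blast
  \<comment> \<open>An open set is a union of sets D(s); the one containing P must be all of
    {P}.\<close>
  then obtain s where s: "s \<in> S" "s \<notin> P" "P \<in> basic_open R s"
    by (auto simp: zariski_closed_def basic_open_def)
  have "basic_open R s \<subseteq> Spec R - zariski_closed R S"
    using s(1) by (auto simp: basic_open_def zariski_closed_def)
  then have sP: "basic_open R s = {P}"
    using s(3) S(2) by blast
  have "s \<in> carrier R" using s(1) S(1) by blast
  then obtain g where g: "g \<in> carrier R" "g \<otimes> g = g" "basic_open R g = {P}"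
    using zero_dimensional_ex_idempotent[OF zd] unfolding sP[symmetric] by blast
  \<comment> \<open>A nonzero idempotent below g has a nonempty basic open set inside {P}, hence the
    same one as g.\<close>
  have "f = g" if f: "f \<in> carrier R" "f \<noteq> \<zero>" "f \<otimes> f = f" "f = g \<otimes> f" for f
  proof (rule idempotent_eq)
    have "basic_open R f \<subseteq> {P}"
      using basic_open_mult[OF g(1) f(1)] g(3) unfolding f(4)[symmetric] by blast
    then show "basic_open R f = basic_open R g"
      using idempotent_eq_zero[OF f(1,3)] f(2) g(3) by (metis subset_singletonD)
  qed (fact f g)+
  moreover have "g \<noteq> \<zero>"
    using g(3) basic_open_zero by auto
  ultimately have "g \<in> primitive_idempotents R"
    using g by (auto simp: primitive_idempotents_def)
  then show thesis
    using that g(3) by blast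
qed

end

theorem theorem5p5:
  fixes R :: "('a, 'b) ring_scheme"
  assumes "cring R"
    and "zero_dimensional R"
  shows "\<exists>f. bij_betw f (primitive_idempotents R) (isolated_points (zariski R))"
proof -
  interpret cring R by fact
  \<comment> \<open>For primitive e the set D(e) is a singleton, so \<open>the_elem\<close> returns
    its unique prime, and equal values force equal basic open sets.\<close>
  let ?f = "\<lambda>e. the_elem (basic_open R e)"
  have "bij_betw ?f (primitive_idempotents R) (isolated_points (zariski R))"
    unfolding bij_betw_def
  proof (intro conjI inj_onI equalityI subsetI)
    fix e f assume ef: "e \<in> primitive_idempotents R" "f \<in> primitive_idempotents R" "?f e = ?f f"
    obtain P Q where PQ: "basic_open R e = {P}" "basic_open R f = {Q}"
      using primitive_idempotent_basic_open[OF assms(2)] ef(1,2) by metis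
    then have "basic_open R e = basic_open R f"
      using ef(3) by simp
    with ef show "e = f"
      using idempotent_eq[of e f] by (simp add: primitive_idempotents_def)
  next
    fix P assume "P \<in> ?f ` primitive_idempotents R"
    then obtain e where e: "e \<in> primitive_idempotents R" "P = ?f e" by blast
    obtain Q where "Q \<in> Spec R" "basic_open R e = {Q}"
      using primitive_idempotent_basic_open[OF assms(2) e(1)] .
    moreover from this have "P = Q"
      using e(2) by simp
    ultimately show "P \<in> isolated_points (zariski R)"
      using openin_basic_open[OF ring_axioms, of e] e(1) topspace_zariski[OF ring_axioms]
      by (auto simp: isolated_points_def primitive_idempotents_def)
  next
    fix P assume "P \<in> isolated_points (zariski R)"
    then obtain e where "e \<in> primitive_idempotents R" "basic_open R e = {P}"
      using isolated_point_primitive_idempotent[OF assms(2)] by blast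
    then show "P \<in> ?f ` primitive_idempotents R"
      by (intro image_eqI[of _ _ e]) simp_all
  qed
  then show ?thesis by blast
qed

end
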